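(* Let $(X,\mu)$ be a measure space with $\mu$ a non-trivial, $\sigma$-finite, positive measure, and let $\mathcal{H}$ be a separable Hilbert space. Every continuous Riesz basis (Riesz-type mapping) $\Psi:X\to\mathcal{H}$ can be written as a discrete Riesz basis.
   Context: A map $\Psi:X\to\mathcal{H}$, $x\mapsto\Psi_x$, is a continuous frame if $x\mapsto\langle f,\Psi_x\rangle$ is measurable for every $f\in\mathcal{H}$ and there are $m,M>0$ with $m\|f\|^2\le\int_X|\langle f,\Psi_x\rangle|^2d\mu(x)\le M\|f\|^2$ for all $f\in\mathcal{H}$. The analysis operator is $C_\Psi:\mathcal{H}\to L^2(X,\mu)$, $C_\Psi f(x)=\langle f,\Psi_x\rangle$, and the redundancy is $R(\Psi):=\dim\big((\operatorname{Ran}C_\Psi)^\perp\big)$, with orthogonal complement in $L^2(X,\mu)$. The notions of continuous Riesz basis and Riesz-type mapping are equivalent and are characterized as the continuous frames with $R(\Psi)=0$. A (discrete) Riesz basis is a discrete frame $\{\psi_i\}_{i\in\mathcal{I}}$ (that is, $\mathcal{I}$ is countable and there are $m,M>0$ with $m\|f\|^2\le\sum_i|\langle f,\psi_i\rangle|^2\le M\|f\|^2$ for all $f\in\mathcal{H}$) such that the range of $f\mapsto\{\langle f,\psi_i\rangle\}_{i\in\mathcal{I}}$ is all of $\ell^2(\mathcal{I})$. "Can be written as" is understood in the sense of identifying the restriction of $\Psi$ to a set $A\subset X$ of positive measure, on which $\langle f,\Psi_x\rangle$ is (almost everywhere) constant for every $f\in\mathcal{H}$, with a single vector $\psi\in\mathcal{H}$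 satisfying $\int_A|\langle f,\Psi_x\rangle|^2d\mu(x)=|\langle f,\psi\rangle|^2$ for all $f\in\mathcal{H}$. *)

theory Defs
  imports "HOL-Analysis.Analysis"
begin

text \<open>The inner product is linear in its first argument, so that the analysis operator
  \<^term>\<open>\<lambda>f x. cinner f (\<Psi> x)\<close> is linear.\<close>

class complex_inner = real_normed_vector +
  fixes scaleC :: "complex \<Rightarrow> 'a \<Rightarrow> 'a" (infixr \<open>*\<^sub>C\<close> 75)
    and cinner :: "'a \<Rightarrow> 'a \<Rightarrow> complex"
  assumes scaleC_add_right: "a *\<^sub>C (x + y) = a *\<^sub>C x + a *\<^sub>C y"
    and scaleC_add_left: "(a + b) *\<^sub>C x = a *\<^sub>C x + b *\<^sub>C x"
    and scaleC_scaleC: "a *\<^sub>C b *\<^sub>C x = (a * b) *\<^sub>C x"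
    and scaleC_one: "1 *\<^sub>C x = x"
    and scaleR_scaleC: "r *\<^sub>R x = complex_of_real r *\<^sub>C x"
    and cinner_commute: "cinner x y = cnj (cinner y x)"
    and cinner_add_left: "cinner (x + y) z = cinner x z + cinner y z"
    and cinner_scaleC_left: "cinner (a *\<^sub>C x) y = a * cinner x y"
    and norm_eq_sqrt_cinner: "norm x = sqrt (Re (cinner x x))"

text \<open>Positivity and definiteness of \<^const>\<open>cinner\<close> follow from the last axiom and the norm axioms.\<close>

lemma cinner_self: "cinner x x = complex_of_real ((norm x)\<^sup>2)"
proof -
  have "Im (cinner x x) = 0"
    using arg_cong[OF cinner_commute[of x x], of Im] by simp
  moreover have "Re (cinner x x) = (norm x)\<^sup>2"
    using norm_eq_sqrt_cinner[of x] norm_ge_zero[of x] by (metis real_sqrt_ge_0_iff real_sqrt_pow2)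
  ultimately show ?thesis
    by (simp add: complex_eq_iff)
qed

class chilbert_space = complex_inner + complete_space

instantiation complex :: chilbert_space
begin

definition "scaleC (a :: complex) (z :: complex) = a * z"
definition "cinner (z :: complex) (w :: complex) = z * cnj w"

instance
  by standard
    (auto simp: scaleC_complex_def cinner_complex_def algebra_simps scaleR_conv_of_real
      cmod_def power2_eq_square)

end

text \<open>Elements of \<open>L\<^sup>2(X, \<mu>)\<close> are represented by functions rather than by classes of functions;
  linear independence, and hence the dimension, is taken modulo almost everywhere equality.\<close>

definition L2_set_of :: "'a measure \<Rightarrow> ('a \<Rightarrow> complex) set" where
  "L2_set_of M = {g \<in> borel_measurable M. integrable M (\<lambda>x. (cmod (g x))\<^sup>2)}"

definition L2_inner :: "'a measure \<Rightarrow> ('a \<Rightarrow> complex) \<Rightarrow> ('a \<Rightarrow> complex) \<Rightarrow> complex" where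
  "L2_inner M g h = (LINT x|M. g x * cnj (h x))"

definition L2_orthogonal :: "'a measure \<Rightarrow> ('a \<Rightarrow> complex) set \<Rightarrow> ('a \<Rightarrow> complex) set" where
  "L2_orthogonal M V = {h \<in> L2_set_of M. \<forall>g\<in>V. L2_inner M g h = 0}"

definition L2_independent :: "'a measure \<Rightarrow> ('a \<Rightarrow> complex) set \<Rightarrow> bool" where
  "L2_independent M S \<longleftrightarrow>
     (\<forall>c. (AE x in M. (\<Sum>s\<in>S. c s * s x) = 0) \<longrightarrow> (\<forall>s\<in>S. c s = 0))"

definition L2_dim :: "'a measure \<Rightarrow> ('a \<Rightarrow> complex) set \<Rightarrow> enat" where
  "L2_dim M V = Sup {enat (card S) | S. finite S \<and> S \<subseteq> V \<and> L2_independent M S}"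

definition continuous_frame :: "'a measure \<Rightarrow> ('a \<Rightarrow> 'h::chilbert_space) \<Rightarrow> bool" where
  "continuous_frame M \<Psi> \<longleftrightarrow>
     (\<forall>f. (\<lambda>x. cinner f (\<Psi> x)) \<in> borel_measurable M) \<and>
     (\<exists>a b. 0 < a \<and> 0 < b \<and>
       (\<forall>f. ennreal (a * (norm f)\<^sup>2) \<le> (\<integral>\<^sup>+x. ennreal ((cmod (cinner f (\<Psi> x)))\<^sup>2) \<partial>M) \<and>
            (\<integral>\<^sup>+x. ennreal ((cmod (cinner f (\<Psi> x)))\<^sup>2) \<partial>M) \<le> ennreal (b * (norm f)\<^sup>2)))"

definition analysis_op :: "('a \<Rightarrow> 'h::chilbert_space) \<Rightarrow> 'h \<Rightarrow> 'a \<Rightarrow> complex" where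
  "analysis_op \<Psi> f = (\<lambda>x. cinner f (\<Psi> x))"

definition redundancy :: "'a measure \<Rightarrow> ('a \<Rightarrow> 'h::chilbert_space) \<Rightarrow> enat" where
  "redundancy M \<Psi> = L2_dim M (L2_orthogonal M (range (analysis_op \<Psi>)))"

definition continuous_Riesz_basis :: "'a measure \<Rightarrow> ('a \<Rightarrow> 'h::chilbert_space) \<Rightarrow> bool" where
  "continuous_Riesz_basis M \<Psi> \<longleftrightarrow> continuous_frame M \<Psi> \<and> redundancy M \<Psi> = 0"

definition discrete_frame :: "'i set \<Rightarrow> ('i \<Rightarrow> 'h::chilbert_space) \<Rightarrow> bool" where
  "discrete_frame I \<psi> \<longleftrightarrow> countable I \<and>
     (\<exists>a b. 0 < a \<and> 0 < b \<and>
       (\<forall>f. (\<lambda>i. (cmod (cinner f (\<psi> i)))\<^sup>2) summable_on I \<and>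
            a * (norm f)\<^sup>2 \<le> (\<Sum>\<^sub>\<infinity>i\<in>I. (cmod (cinner f (\<psi> i)))\<^sup>2) \<and>
            (\<Sum>\<^sub>\<infinity>i\<in>I. (cmod (cinner f (\<psi> i)))\<^sup>2) \<le> b * (norm f)\<^sup>2))"

definition ell2_on :: "'i set \<Rightarrow> ('i \<Rightarrow> complex) set" where
  "ell2_on I = {c \<in> extensional I. (\<lambda>i. (cmod (c i))\<^sup>2) summable_on I}"

definition discrete_Riesz_basis :: "'i set \<Rightarrow> ('i \<Rightarrow> 'h::chilbert_space) \<Rightarrow> bool" where
  "discrete_Riesz_basis I \<psi> \<longleftrightarrow>
     discrete_frame I \<psi> \<and> range (\<lambda>f. \<lambda>i\<in>I. cinner f (\<psi> i)) = ell2_on I"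

text \<open>The family \<open>\<psi>\<close> over \<open>I\<close> is obtained from \<open>\<Psi>\<close> by cutting \<open>X\<close>, up to a null set, into
  disjoint pieces \<open>A i\<close> of positive measure on which \<open>\<Psi>\<close> is weakly constant, and replacing
  \<open>\<Psi>\<close> on \<open>A i\<close> by the single vector \<open>\<psi> i\<close>. The exceptional null set in the weak constancy
  may depend on \<open>f\<close>.\<close>

definition written_as ::
  "'a measure \<Rightarrow> ('a \<Rightarrow> 'h::chilbert_space) \<Rightarrow> 'i set \<Rightarrow> ('i \<Rightarrow> 'a set) \<Rightarrow> ('i \<Rightarrow> 'h) \<Rightarrow> bool" where
  "written_as M \<Psi> I A \<psi> \<longleftrightarrow>
     disjoint_family_on A I \<and>
     (AE x in M. x \<in> (\<Union>i\<in>I. A i)) \<and>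
     (\<forall>i\<in>I. A i \<in> sets M \<and> 0 < emeasure M (A i) \<and>
       (\<forall>f. \<exists>c. AE x in M. x \<in> A i \<longrightarrow> cinner f (\<Psi> x) = c) \<and>
       (\<forall>f. (\<integral>\<^sup>+x\<in>A i. ennreal ((cmod (cinner f (\<Psi> x)))\<^sup>2) \<partial>M)
              = ennreal ((cmod (cinner f (\<psi> i)))\<^sup>2)))"

end

theory Submission
  imports Defs
begin

text \<open>Since the redundancy vanishes, every function in \<open>L\<^sup>2(X, \<mu>)\<close> is almost everywhere of the form
  \<open>\<langle>f, \<Psi>\<^sub>x\<rangle>\<close>. For indicator functions this forces every non-null subset of
  \<open>{x. \<parallel>\<Psi>\<^sub>x\<parallel> \<le> K}\<close> to have measure bounded below, so \<open>\<mu>\<close> is purely atomic; on an atom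
  \<open>\<Psi>\<close> is almost everywhere constant, because \<open>\<H>\<close> is separable. Hence countably many level sets
  of \<open>\<Psi>\<close> exhaust \<open>X\<close> up to a null set, and rescaling the value on each by the square root of
  its measure yields the discrete family.\<close>

section \<open>Complex inner product spaces\<close>

lemma cinner_add_right: "cinner x (y + z) = cinner x y + cinner (x::'a::complex_inner) z"
  by (subst (1 2 3) cinner_commute) (simp add: cinner_add_left)

lemma cinner_scaleC_right: "cinner x (a *\<^sub>C y) = cnj a * cinner (x::'a::complex_inner) y"
  by (subst (1 2) cinner_commute) (simp add: cinner_scaleC_left)

lemma cinner_scaleR_left: "cinner (r *\<^sub>R x) y = of_real r * cinner (x::'a::complex_inner) y"
  by (simp add: scaleR_scaleC cinner_scaleC_left)

lemma cinner_scaleR_right: "cinner x (r *\<^sub>R y) = of_real r * cinner (x::'a::complex_inner) y"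
  by (simp add: scaleR_scaleC cinner_scaleC_right)

lemma cinner_diff_left: "cinner (x - y) z = cinner x z - cinner (y::'a::complex_inner) z"
  using cinner_add_left[of x "-1 *\<^sub>R y" z] cinner_scaleR_left[of "-1" y z] by simp

lemma norm_scaleC: "norm (a *\<^sub>C x) = cmod a * norm (x::'a::complex_inner)"
proof -
  have "(norm (a *\<^sub>C x))\<^sup>2 = Re (cinner (a *\<^sub>C x) (a *\<^sub>C x))"
    by (simp add: cinner_self del: of_real_power)
  also have "\<dots> = Re ((a * cnj a) * cinner x x)"
    by (simp add: cinner_scaleC_left cinner_scaleC_right mult_ac)
  also have "\<dots> = (cmod a * norm x)\<^sup>2"
    by (simp only: complex_norm_square[symmetric] cinner_self of_real_mult[symmetric] Re_complex_of_real
        power_mult_distrib)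
  finally show ?thesis by simp
qed

text \<open>Reverses the usual order: the triangle inequality is already an axiom of the norm, so
  expanding the square of \<open>norm (x + y)\<close> and comparing yields the real part of
  Cauchy-Schwarz.\<close>

lemma Re_cinner_le: "Re (cinner x y) \<le> norm x * norm (y::'a::complex_inner)"
proof -
  have "(norm (x + y))\<^sup>2 = Re (cinner (x + y) (x + y))"
    by (simp add: cinner_self del: of_real_power)
  also have "\<dots> = (norm x)\<^sup>2 + (norm y)\<^sup>2 + 2 * Re (cinner x y)"
    using arg_cong[OF cinner_commute[of y x], of Re]
    by (simp add: cinner_add_left cinner_add_right cinner_self[of x] cinner_self[of y] del: of_real_power)
  finally have "(norm (x + y))\<^sup>2 = (norm x)\<^sup>2 + (norm y)\<^sup>2 + 2 * Re (cinner x y)" .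
  moreover have "(norm (x + y))\<^sup>2 \<le> (norm x + norm y)\<^sup>2"
    by (simp add: norm_triangle_ineq power_mono)
  ultimately show ?thesis
    by (simp add: power2_sum)
qed

text \<open>The full Cauchy-Schwarz inequality. Multiplying \<open>x\<close> by the unimodular
  scalar \<open>?u\<close> makes the inner product real and nonnegative without changing
  \<open>norm x\<close>, which reduces it to the bound on the real part.\<close>

lemma cmod_cinner_le: "cmod (cinner x y) \<le> norm x * norm (y::'a::complex_inner)"
proof (cases "cinner x y = 0")
  case False
  let ?u = "cnj (sgn (cinner x y))"
  have "?u * cinner x y = complex_of_real (cmod (cinner x y))"
    using False by (simp add: sgn_eq field_simps complex_norm_square[symmetric] power2_eq_square)
  then have "cmod (cinner x y) = Re (cinner (?u *\<^sub>C x) y)"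
    by (simp add: cinner_scaleC_left)
  also have "\<dots> \<le> norm (?u *\<^sub>C x) * norm y"
    by (rule Re_cinner_le)
  also have "\<dots> = norm x * norm y"
    using False by (simp add: norm_scaleC norm_sgn)
  finally show ?thesis .
qed simp

lemma bounded_linear_cinner_left: "bounded_linear (\<lambda>x. cinner x (y::'a::complex_inner))"
  by (rule bounded_linear_intro[where K = "norm y"])
    (simp_all add: cinner_add_left cinner_scaleR_left cmod_cinner_le scaleR_conv_of_real)

lemmas continuous_on_cinner_left [continuous_intros] =
  bounded_linear.continuous_on[OF bounded_linear_cinner_left]

lemma closed_dense_imp_UNIV:
  assumes "closure D = UNIV" "closed {f. P f}" "\<And>f. f \<in> D \<Longrightarrow> P f"
  shows "P f"
proof -
  have "closure D \<subseteq> {f. P f}"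
    using assms(2,3) by (intro closure_minimal) auto
  then show ?thesis using assms(1) by auto
qed

text \<open>By continuity the equality extends to all \<open>f\<close>, in particular to
  \<open>u - v\<close>. With \<open>D\<close> countable, an identity between vectors becomes
  countably many scalar conditions, which suits null sets and measurability.\<close>

lemma cinner_eq_on_dense:
  fixes u v :: "'h::complex_inner"
  assumes "closure D = UNIV" "\<And>f. f \<in> D \<Longrightarrow> cinner f u = cinner f v"
  shows "u = v"
proof -
  have "cinner f u = cinner f v" for f
    by (rule closed_dense_imp_UNIV[OF assms(1) _ assms(2)])
      (auto intro!: closed_Collect_eq continuous_intros)
  from this[of "u - v"] have "cinner (u - v) (u - v) = 0"
    using cinner_add_right[of "u - v" u "(-1) *\<^sub>R v"] cinner_scaleR_right[of "u - v" "-1" v] by simp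
  then show ?thesis by (simp add: cinner_self)
qed

lemma norm_le_on_dense:
  fixes u :: "'h::complex_inner"
  assumes "closure D = UNIV" "\<And>f. f \<in> D \<Longrightarrow> cmod (cinner f u) \<le> K * norm f"
  shows "cmod (cinner f u) \<le> K * norm f"
  by (rule closed_dense_imp_UNIV[OF assms(1) _ assms(2)])
      (auto intro!: closed_Collect_le continuous_intros)

section \<open>Square integrable functions\<close>

lemma L2_set_of_measurable [measurable_dest]: "g \<in> L2_set_of M \<Longrightarrow> g \<in> borel_measurable M"
  and L2_set_of_integrable: "g \<in> L2_set_of M \<Longrightarrow> integrable M (\<lambda>x. (cmod (g x))\<^sup>2)"
  by (auto simp: L2_set_of_def)

lemma L2_set_of_iff_nn_integral:
  "g \<in> L2_set_of M \<longleftrightarrow> g \<in> borel_measurable M \<and> (\<integral>\<^sup>+x. ennreal ((cmod (g x))\<^sup>2) \<partial>M) < \<infinity>"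
  by (auto simp: L2_set_of_def integrable_iff_bounded)

lemma L2_set_of_diff:
  assumes "g \<in> L2_set_of M" "h \<in> L2_set_of M"
  shows "(\<lambda>x. g x - h x) \<in> L2_set_of M"
proof -
  have [measurable]: "g \<in> borel_measurable M" "h \<in> borel_measurable M"
    using assms by (auto dest: L2_set_of_measurable)
  have *: "(cmod (u - v))\<^sup>2 \<le> 2 * (cmod u)\<^sup>2 + 2 * (cmod v)\<^sup>2" for u v
  proof -
    have "(cmod (u - v))\<^sup>2 \<le> (cmod u + cmod v)\<^sup>2"
      by (simp add: norm_triangle_ineq4 power_mono)
    also have "\<dots> \<le> 2 * (cmod u)\<^sup>2 + 2 * (cmod v)\<^sup>2"
      using sum_squares_bound[of "cmod u" "cmod v"] by (simp add: power2_sum)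
    finally show ?thesis .
  qed
  have "integrable M (\<lambda>x. (cmod (g x - h x))\<^sup>2)"
  proof (rule Bochner_Integration.integrable_bound)
    show "integrable M (\<lambda>x. 2 * (cmod (g x))\<^sup>2 + 2 * (cmod (h x))\<^sup>2)"
      using assms by (simp add: L2_set_of_integrable)
  qed (use * in auto)
  then show ?thesis by (simp add: L2_set_of_def)
qed

lemma L2_set_of_integrable_mult_cnj:
  assumes "g \<in> L2_set_of M" "h \<in> L2_set_of M"
  shows "integrable M (\<lambda>x. g x * cnj (h x))"
proof -
  have [measurable]: "g \<in> borel_measurable M" "h \<in> borel_measurable M"
    using assms by (auto dest: L2_set_of_measurable)
  have [measurable]: "cnj \<in> borel_measurable borel"
    by (intro borel_measurable_continuous_onI continuous_intros)
  have *: "cmod u * cmod v \<le> (cmod u)\<^sup>2 + (cmod v)\<^sup>2" for u v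
    using sum_squares_bound[of "cmod u" "cmod v"] mult_nonneg_nonneg[OF norm_ge_zero norm_ge_zero, of u v] by linarith
  show ?thesis
  proof (rule Bochner_Integration.integrable_bound)
    show "integrable M (\<lambda>x. (cmod (g x))\<^sup>2 + (cmod (h x))\<^sup>2)"
      using assms by (simp add: L2_set_of_integrable)
  qed (use * in \<open>auto simp: norm_mult\<close>)
qed

section \<open>Continuous Riesz bases\<close>

text \<open>A single function that is not almost everywhere zero forms an independent set of size
  one and so forces the dimension to be at least 1.\<close>

lemma L2_dim_0D:
  assumes "L2_dim M V = 0" "h \<in> V"
  shows "AE x in M. h x = 0"
proof (rule ccontr)
  assume *: "\<not> (AE x in M. h x = 0)"
  have "L2_independent M {h}"
    unfolding L2_independent_def using * by (auto split: if_splits)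
  then have "enat (card {h}) \<le> L2_dim M V"
    unfolding L2_dim_def using assms(2) by (intro Sup_upper) blast
  then show False
    using assms(1) by (simp add: zero_enat_def)
qed

text \<open>The upper frame bound makes the extended nonnegative integrals finite, so the frame
  inequalities can be restated with real-valued integrals.\<close>

lemma continuous_frame_bounds:
  assumes "continuous_frame M \<Psi>"
  obtains a b where "0 < a" "0 < b"
    "\<And>f. (\<lambda>x. cinner f (\<Psi> x)) \<in> L2_set_of M"
    "\<And>f. a * (norm f)\<^sup>2 \<le> (LINT x|M. (cmod (cinner f (\<Psi> x)))\<^sup>2)"
    "\<And>f. (LINT x|M. (cmod (cinner f (\<Psi> x)))\<^sup>2) \<le> b * (norm f)\<^sup>2"
proof -
  from assms obtain a b where ab: "0 < a" "0 < b"
    and meas: "\<And>f. (\<lambda>x. cinner f (\<Psi> x)) \<in> borel_measurable M"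
    and lo: "\<And>f. ennreal (a * (norm f)\<^sup>2) \<le> (\<integral>\<^sup>+x. ennreal ((cmod (cinner f (\<Psi> x)))\<^sup>2) \<partial>M)"
    and up: "\<And>f. (\<integral>\<^sup>+x. ennreal ((cmod (cinner f (\<Psi> x)))\<^sup>2) \<partial>M) \<le> ennreal (b * (norm f)\<^sup>2)"
    unfolding continuous_frame_def by auto
  have L2: "(\<lambda>x. cinner f (\<Psi> x)) \<in> L2_set_of M" for f
    using meas up[of f] by (auto simp: L2_set_of_iff_nn_integral intro: le_less_trans)
  have eq: "(\<integral>\<^sup>+x. ennreal ((cmod (cinner f (\<Psi> x)))\<^sup>2) \<partial>M) = ennreal (LINT x|M. (cmod (cinner f (\<Psi> x)))\<^sup>2)" for f
    by (intro nn_integral_eq_integral L2_set_of_integrable[OF L2]) auto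
  show thesis
    using lo up ab unfolding eq by (intro that[OF ab L2]) (simp_all add: ennreal_le_iff)
qed

text \<open>A least squares problem over \<open>f\<close>: completeness of \<^typ>\<open>'h\<close> and the lower frame bound
  provide a minimiser, whose residual is orthogonal to the range and hence vanishes.\<close>

lemma analysis_op_surj:
  fixes \<Psi> :: "'a \<Rightarrow> 'h::chilbert_space"
  assumes Riesz: "continuous_Riesz_basis M \<Psi>" and g: "g \<in> L2_set_of M"
  obtains f where "AE x in M. cinner f (\<Psi> x) = g x"
proof -
  from Riesz obtain a b where a: "0 < a"
    and L2: "\<And>f. (\<lambda>x. cinner f (\<Psi> x)) \<in> L2_set_of M"
    and lo: "\<And>f. a * (norm f)\<^sup>2 \<le> (LINT x|M. (cmod (cinner f (\<Psi> x)))\<^sup>2)"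
    unfolding continuous_Riesz_basis_def by (auto elim: continuous_frame_bounds)
  define r where "r f x = g x - cinner f (\<Psi> x)" for f x
  define J where "J f = (LINT x|M. (cmod (r f x))\<^sup>2)" for f
  have rL2: "r f \<in> L2_set_of M" for f
    unfolding r_def by (rule L2_set_of_diff[OF g L2])
  note [measurable] = L2_set_of_measurable[OF L2] L2_set_of_measurable[OF g] L2_set_of_measurable[OF rL2]
  note [simp, intro] = L2_set_of_integrable[OF L2] L2_set_of_integrable[OF rL2]
  define d where "d = Inf (range J)"
  have "bdd_below (range J)"
    by (rule bdd_belowI[where m = 0]) (auto simp: J_def)
  then have d_le: "d \<le> J f" for f
    unfolding d_def by (intro cInf_lower) auto
  have "\<exists>f. J f < d + 1 / real (Suc n)" for n
    using cInf_lessD[of "range J" "d + 1 / real (Suc n)"] by (auto simp: d_def)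
  then obtain F where F: "\<And>n. J (F n) < d + 1 / real (Suc n)"
    by metis
  \<comment> \<open>Parallelogram law in L2 for the residuals of \<open>e\<close> and
    \<open>f\<close>: \<open>r\<close> is affine, so the midpoint has the averaged residual, and the
    difference of the residuals is \<open>cinner (e - f) (\<Psi> x)\<close>.\<close>
  have para: "(LINT x|M. (cmod (cinner (e - f) (\<Psi> x)))\<^sup>2) + 4 * J ((1/2) *\<^sub>R (e + f)) = 2 * J e + 2 * J f" for e f
  proof -
    have pw: "(cmod (u - v))\<^sup>2 + 4 * (cmod (w - (u + v) / 2))\<^sup>2 = 2 * (cmod (w - u))\<^sup>2 + 2 * (cmod (w - v))\<^sup>2" for u v w
      unfolding cmod_power2 by (simp add: power2_eq_square field_simps)
    have "(LINT x|M. (cmod (cinner (e - f) (\<Psi> x)))\<^sup>2) + 4 * J ((1/2) *\<^sub>R (e + f))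
       = (LINT x|M. (cmod (cinner (e - f) (\<Psi> x)))\<^sup>2 + 4 * (cmod (r ((1/2) *\<^sub>R (e + f)) x))\<^sup>2)"
      unfolding J_def by simp
    also have "\<dots> = (LINT x|M. 2 * (cmod (r e x))\<^sup>2 + 2 * (cmod (r f x))\<^sup>2)"
      by (intro Bochner_Integration.integral_cong refl)
        (use pw in \<open>simp add: r_def cinner_diff_left cinner_scaleR_left cinner_add_left\<close>)
    also have "\<dots> = 2 * J e + 2 * J f"
      unfolding J_def by simp
    finally show ?thesis .
  qed
  \<comment> \<open>The midpoint term is at least \<open>4 * d\<close> and cancels the two
    contributions \<open>2 * d\<close> of the nearly minimal values; only the error terms
    remain.\<close>
  have dist: "a * (norm (F m - F n))\<^sup>2 < 2 / real (Suc m) + 2 / real (Suc n)" for m n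
    using lo[of "F m - F n"] para[of "F m" "F n"] d_le[of "(1/2) *\<^sub>R (F m + F n)"] F[of m] F[of n]
    by linarith
  have "Cauchy F"
  proof (rule CauchyI)
    fix e :: real assume e: "0 < e"
    then obtain N where N: "1 / real (Suc N) < a * e\<^sup>2 / 4"
      using reals_Archimedean[of "a * e\<^sup>2 / 4"] a by (auto simp: inverse_eq_divide)
    have "norm (F m - F n) < e" if "N \<le> m" "N \<le> n" for m n
    proof -
      have "1 / real (Suc m) \<le> 1 / real (Suc N)" "1 / real (Suc n) \<le> 1 / real (Suc N)"
        using that by (auto intro!: divide_left_mono)
      then have "a * (norm (F m - F n))\<^sup>2 < a * e\<^sup>2"
        using dist[of m n] N by linarith
      then show ?thesis
        using a e by (auto intro: power_less_imp_less_base[where n = 2])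
    qed
    then show "\<exists>N. \<forall>m\<ge>N. \<forall>n\<ge>N. norm (F m - F n) < e" by blast
  qed
  then obtain f where f: "F \<longlonglongrightarrow> f"
    using Cauchy_convergent_iff convergent_def by blast
  \<comment> \<open>Lower semicontinuity of \<open>J\<close>: the residuals of \<open>F n\<close>
    converge pointwise because \<open>F\<close> converges in norm, and Fatou's lemma handles the
    integrals.\<close>
  have "J f \<le> d"
  proof -
    have J_nn: "ennreal (J e) = (\<integral>\<^sup>+x. ennreal ((cmod (r e x))\<^sup>2) \<partial>M)" for e
      unfolding J_def by (intro nn_integral_eq_integral[symmetric]) auto
    have "(\<lambda>n. ennreal ((cmod (r (F n) x))\<^sup>2)) \<longlonglongrightarrow> ennreal ((cmod (r f x))\<^sup>2)" for x
      unfolding r_def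
      by (intro tendsto_ennrealI tendsto_intros bounded_linear.tendsto[OF bounded_linear_cinner_left] f)
    then have "ennreal ((cmod (r f x))\<^sup>2) = liminf (\<lambda>n. ennreal ((cmod (r (F n) x))\<^sup>2))" for x
      by (intro lim_imp_Liminf[symmetric]) simp_all
    then have "ennreal (J f) = (\<integral>\<^sup>+x. liminf (\<lambda>n. ennreal ((cmod (r (F n) x))\<^sup>2)) \<partial>M)"
      unfolding J_nn by simp
    also have "\<dots> \<le> liminf (\<lambda>n. ennreal (J (F n)))"
      unfolding J_nn by (rule nn_integral_liminf) measurable
    also have "\<dots> \<le> liminf (\<lambda>n. ennreal (d + 1 / real (Suc n)))"
      by (intro Liminf_mono always_eventually allI ennreal_leI less_imp_le F)
    also have "\<dots> = ennreal (d + 0)"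
      by (intro lim_imp_Liminf tendsto_ennrealI tendsto_intros LIMSEQ_Suc[OF lim_1_over_n]) simp
    finally have "ennreal (J f) \<le> ennreal d" by simp
    moreover have "0 \<le> d"
      unfolding d_def by (rule cInf_greatest) (auto simp: J_def)
    ultimately show ?thesis by (simp add: ennreal_le_iff)
  qed
  have "L2_inner M (\<lambda>x. cinner e (\<Psi> x)) (r f) = 0" for e
  proof (rule ccontr)
    define p where "p = L2_inner M (\<lambda>x. cinner e (\<Psi> x)) (r f)"
    define q where "q = (LINT x|M. (cmod (cinner e (\<Psi> x)))\<^sup>2)"
    assume "L2_inner M (\<lambda>x. cinner e (\<Psi> x)) (r f) \<noteq> 0"
    then have p: "p \<noteq> 0" by (simp add: p_def)
    have q: "0 \<le> q" by (simp add: q_def)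
    note int = L2_set_of_integrable_mult_cnj[OF L2 rL2, of e f]
    have J_shift: "J (f + z *\<^sub>C e) = J f - 2 * Re (z * p) + (cmod z)\<^sup>2 * q" for z
    proof -
      have pw: "(cmod (w - z * v))\<^sup>2 = (cmod w)\<^sup>2 - 2 * Re (z * (v * cnj w)) + (cmod z)\<^sup>2 * (cmod v)\<^sup>2" for v w
        unfolding cmod_power2 by (simp add: power2_eq_square algebra_simps)
      have "r (f + z *\<^sub>C e) x = r f x - z * cinner e (\<Psi> x)" for x
        by (simp add: r_def cinner_add_left cinner_scaleC_left)
      then have "J (f + z *\<^sub>C e) = (LINT x|M. (cmod (r f x))\<^sup>2
          - 2 * Re (z * (cinner e (\<Psi> x) * cnj (r f x))) + (cmod z)\<^sup>2 * (cmod (cinner e (\<Psi> x)))\<^sup>2)"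
        unfolding J_def by (simp add: pw)
      also have "\<dots> = J f - 2 * (LINT x|M. Re (z * (cinner e (\<Psi> x) * cnj (r f x)))) + (cmod z)\<^sup>2 * q"
        using integrable_Re[OF Bochner_Integration.integrable_mult_right[OF int, of z]]
        unfolding J_def q_def by (simp del: times_complex.sel)
      also have "(LINT x|M. Re (z * (cinner e (\<Psi> x) * cnj (r f x)))) = Re (z * p)"
        unfolding p_def L2_inner_def
        using integral_Re[OF Bochner_Integration.integrable_mult_right[OF int, of z]] by (simp del: times_complex.sel)
      finally show ?thesis .
    qed
    \<comment> \<open>Step length for a descent from \<open>f\<close> in the direction
      \<open>cnj p *\<^sub>C e\<close>. With \<open>t * q < 1\<close> the quadratic term cannot
      outweigh the linear gain, so \<open>J\<close> would drop below \<open>d\<close>; the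
      \<open>+ 1\<close> covers the case \<open>q = 0\<close>.\<close>
    define t where "t = 1 / (q + 1)"
    have t: "0 < t" "t * q < 1" using q by (auto simp: t_def field_simps)
    have "0 \<le> - 2 * Re ((of_real t * cnj p) * p) + (cmod (of_real t * cnj p))\<^sup>2 * q"
      using J_shift[of "of_real t * cnj p"] d_le[of "f + (of_real t * cnj p) *\<^sub>C e"] \<open>J f \<le> d\<close> by linarith
    also have "cnj p * p = of_real ((cmod p)\<^sup>2)"
      by (metis complex_norm_square mult.commute)
    then have "Re ((of_real t * cnj p) * p) = t * (cmod p)\<^sup>2"
      by (simp add: mult.assoc del: of_real_power)
    also have "- 2 * (t * (cmod p)\<^sup>2) + (cmod (of_real t * cnj p))\<^sup>2 * q = t * (cmod p)\<^sup>2 * (t * q - 2)"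
      by (simp add: norm_mult power_mult_distrib) (simp add: power2_eq_square algebra_simps)
    also have "\<dots> < 0"
      using t p by (intro mult_pos_neg) auto
    finally show False by simp
  qed
  then have "r f \<in> L2_orthogonal M (range (analysis_op \<Psi>))"
    using rL2 by (auto simp: L2_orthogonal_def analysis_op_def)
  then have "AE x in M. r f x = 0"
    using Riesz unfolding continuous_Riesz_basis_def redundancy_def by (auto intro: L2_dim_0D)
  then show thesis
    by (intro that[of f]) (auto simp: r_def)
qed

section \<open>Atoms and level sets\<close>

text \<open>A set of nonzero measure is not swallowed by the exceptional null set. This turns almost
  everywhere statements into statements at a concrete point.\<close>

lemma AE_imp_ex_mem:
  assumes "AE x in M. x \<in> E \<longrightarrow> P x" "emeasure M E \<noteq> 0"
  shows "\<exists>x\<in>E. P x"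
proof (rule ccontr)
  assume "\<not> (\<exists>x\<in>E. P x)"
  with assms(1) have "AE x in M. x \<in> E \<longrightarrow> x \<in> {}"
    by (auto elim: eventually_mono)
  then have "emeasure M E \<le> emeasure M {}"
    by (rule emeasure_mono_AE) simp
  then show False using assms(2) by simp
qed

text \<open>For each set \<open>U\<close> of a countable basis, the atom lies almost entirely inside
  or almost entirely outside the preimage of \<open>U\<close>. Off countably many null sets all
  values of \<open>h\<close> thus belong to the same basic open sets, and the T1 property makes them
  equal.\<close>

lemma atom_AE_const:
  fixes h :: "'a \<Rightarrow> 'b::{second_countable_topology, t1_space}"
  assumes h [measurable]: "h \<in> borel_measurable M" and E [measurable]: "E \<in> sets M"
    and E0: "emeasure M E \<noteq> 0"
    and atom: "\<And>P. P \<in> sets M \<Longrightarrow> P \<subseteq> E \<Longrightarrow> emeasure M P = 0 \<or> emeasure M (E - P) = 0"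
  obtains c where "AE x in M. x \<in> E \<longrightarrow> h x = c"
proof -
  obtain B :: "'b set set" where B: "countable B" "topological_basis B"
    using ex_countable_basis by blast
  have "\<exists>s. AE x in M. x \<in> E \<longrightarrow> (h x \<in> U \<longleftrightarrow> s)" if "U \<in> B" for U
  proof -
    have [measurable]: "U \<in> sets borel"
      using that B(2) by (simp add: topological_basis_open)
    define P where "P = {x \<in> space M. x \<in> E \<and> h x \<in> U}"
    have [measurable]: "P \<in> sets M" unfolding P_def by measurable
    have sp: "x \<in> E \<Longrightarrow> x \<in> space M" for x
      using sets.sets_into_space[OF E] by auto
    consider "emeasure M P = 0" | "emeasure M (E - P) = 0"
      using atom[of P] by (auto simp: P_def)
    then show ?thesis
    proof cases
      case 1
      then have "AE x in M. x \<notin> P" by (intro AE_not_in) auto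
      then have "AE x in M. x \<in> E \<longrightarrow> (h x \<in> U \<longleftrightarrow> False)"
        by eventually_elim (auto simp: P_def sp)
      then show ?thesis by blast
    next
      case 2
      then have "AE x in M. x \<notin> E - P" by (intro AE_not_in) auto
      then have "AE x in M. x \<in> E \<longrightarrow> (h x \<in> U \<longleftrightarrow> True)"
        by eventually_elim (auto simp: P_def sp)
      then show ?thesis by blast
    qed
  qed
  then obtain s where "\<And>U. U \<in> B \<Longrightarrow> AE x in M. x \<in> E \<longrightarrow> (h x \<in> U \<longleftrightarrow> s U)"
    by metis
  then have *: "AE x in M. \<forall>U\<in>B. x \<in> E \<longrightarrow> (h x \<in> U \<longleftrightarrow> s U)"
    by (intro AE_ball_countable' B(1))
  then have "AE x in M. x \<in> E \<longrightarrow> (\<forall>U\<in>B. h x \<in> U \<longleftrightarrow> s U)"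
    by eventually_elim auto
  from AE_imp_ex_mem[OF this E0] obtain z where z: "\<forall>U\<in>B. h z \<in> U \<longleftrightarrow> s U" by auto
  from * have "AE x in M. x \<in> E \<longrightarrow> h x = h z"
  proof eventually_elim
    case (elim x)
    show ?case
    proof (intro impI, rule ccontr)
      assume x: "x \<in> E" "h x \<noteq> h z"
      then have "open (- {h z})" "h x \<in> - {h z}" by auto
      from topological_basisE[OF B(2) this] obtain U where "U \<in> B" "h x \<in> U" "U \<subseteq> - {h z}" .
      with elim z x(1) show False by auto
    qed
  qed
  then show thesis by (rule that)
qed

text \<open>The push-forward of an equivalent finite measure has only countably many point masses.\<close>

lemma (in sigma_finite_measure) countable_level_sets:
  assumes meas: "\<And>v. {x \<in> space M. \<Psi> x = v} \<in> sets M"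
  shows "countable {v. emeasure M {x \<in> space M. \<Psi> x = v} \<noteq> 0}"
proof -
  obtain h where h [measurable]: "h \<in> borel_measurable M" and fin: "integral\<^sup>N M h \<noteq> \<infinity>"
    and pos: "\<And>x. x \<in> space M \<Longrightarrow> 0 < h x"
    using Ex_finite_integrable_function by auto
  \<comment> \<open>The largest \<sigma>-algebra on the codomain that makes \<open>\<Psi>\<close>
    measurable. It contains the singletons because the level sets are measurable, which is all that
    the point masses require.\<close>
  define \<A> where "\<A> = {B. \<Psi> -` B \<inter> space M \<in> sets M}"
  define N where "N = distr (density M h) (sigma UNIV \<A>) \<Psi>"
  have \<Psi>: "\<Psi> \<in> measurable (density M h) (sigma UNIV \<A>)"
    by (rule measurable_measure_of) (auto simp: \<A>_def)
  have "finite_measure (density M h)"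
    using fin by (intro finite_measureI) (simp add: emeasure_density cong: nn_integral_cong)
  then interpret N: finite_measure N
    unfolding N_def by (rule finite_measure.finite_measure_distr[OF _ \<Psi>])
  have "measure N {v} \<noteq> 0" if v: "emeasure M {x \<in> space M. \<Psi> x = v} \<noteq> 0" for v
  proof -
    have vimage: "\<Psi> -` {v} \<inter> space M = {x \<in> space M. \<Psi> x = v}" by auto
    then have "{v} \<in> sets (sigma UNIV \<A>)"
      using meas[of v] by (auto simp: \<A>_def)
    from emeasure_distr[OF \<Psi> this]
    have "emeasure N {v} = emeasure (density M h) {x \<in> space M. \<Psi> x = v}"
      by (simp add: N_def vimage)
    moreover have "{x \<in> space M. \<Psi> x = v} \<notin> null_sets (density M h)"
    proof
      assume "{x \<in> space M. \<Psi> x = v} \<in> null_sets (density M h)"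
      then have "AE x in M. \<Psi> x = v \<longrightarrow> h x = 0"
        by (auto simp: null_sets_density_iff)
      then have "AE x in M. x \<in> {x \<in> space M. \<Psi> x = v} \<longrightarrow> False"
        using AE_space by eventually_elim (use pos in fastforce)
      from AE_imp_ex_mem[OF this v] show False by auto
    qed
    ultimately have "emeasure N {v} \<noteq> 0"
      using meas[of v] by (auto simp: null_sets_def)
    then show ?thesis by (simp add: N.emeasure_eq_measure)
  qed
  then show ?thesis
    by (intro countable_subset[OF _ N.countable_support]) auto
qed

text \<open>Only weak measurability of \<open>\<Psi>\<close> is available, so equality with
  \<open>v\<close> is tested against the countable dense set \<open>D\<close>.\<close>

lemma level_set_measurable:
  fixes \<Psi> :: "'a \<Rightarrow> 'h::complex_inner"
  assumes D: "countable D" "closure D = (UNIV :: 'h set)" and [measurable]: "\<And>f. (\<lambda>x. cinner f (\<Psi> x)) \<in> borel_measurable M"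
  shows "{x \<in> space M. \<Psi> x = v} \<in> sets M"
proof -
  have "{x \<in> space M. \<Psi> x = v} = {x \<in> space M. \<forall>f\<in>D. cinner f (\<Psi> x) = cinner f v}"
    by (auto intro: cinner_eq_on_dense[OF D(2)])
  also have "\<dots> \<in> sets M"
    by (rule sets.sets_Collect_countable_All'[OF _ D(1)]) measurable
  finally show ?thesis .
qed

text \<open>The norm bound is dual to a Cauchy-Schwarz bound tested on the countable set
  \<open>D\<close>; the converse direction extends that bound by density to
  \<open>f = u\<close>.\<close>

lemma norm_le_set_measurable:
  fixes \<Psi> :: "'a \<Rightarrow> 'h::complex_inner"
  assumes D: "countable D" "closure D = (UNIV :: 'h set)" and [measurable]: "\<And>f. (\<lambda>x. cinner f (\<Psi> x)) \<in> borel_measurable M"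
    and K: "0 \<le> K"
  shows "{x \<in> space M. norm (\<Psi> x) \<le> K} \<in> sets M"
proof -
  have "norm u \<le> K \<longleftrightarrow> (\<forall>f\<in>D. cmod (cinner f u) \<le> K * norm f)" for u
  proof
    assume u: "norm u \<le> K"
    show "\<forall>f\<in>D. cmod (cinner f u) \<le> K * norm f"
    proof
      fix f
      have "cmod (cinner f u) \<le> norm f * norm u"
        by (rule cmod_cinner_le)
      also have "\<dots> \<le> norm f * K"
        using u by (rule mult_left_mono) simp
      finally show "cmod (cinner f u) \<le> K * norm f"
        by (simp add: mult.commute)
    qed
  next
    assume *: "\<forall>f\<in>D. cmod (cinner f u) \<le> K * norm f"
    have "cmod (cinner u u) \<le> K * norm u"
      by (rule norm_le_on_dense[OF D(2)]) (use * in auto)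
    then have "norm u * norm u \<le> K * norm u"
      by (simp add: cinner_self power2_eq_square norm_mult)
    then show "norm u \<le> K"
      using K by (cases "u = 0") auto
  qed
  then have "{x \<in> space M. norm (\<Psi> x) \<le> K} = {x \<in> space M. \<forall>f\<in>D. cmod (cinner f (\<Psi> x)) \<le> K * norm f}"
    by auto
  also have "\<dots> \<in> sets M"
    by (rule sets.sets_Collect_countable_All'[OF _ D(1)]) measurable
  finally show ?thesis .
qed

lemma indicator_in_L2_set_of:
  assumes "C \<in> sets M" "emeasure M C < \<infinity>"
  shows "indicator C \<in> L2_set_of M"
proof -
  have "(\<integral>\<^sup>+x. ennreal ((cmod (indicator C x))\<^sup>2) \<partial>M) = (\<integral>\<^sup>+x. indicator C x \<partial>M)"
    by (intro nn_integral_cong) (simp split: split_indicator)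
  then show ?thesis
    using assms by (simp add: L2_set_of_iff_nn_integral)
qed

text \<open>If the indicator function of \<open>C\<close> is the image of \<open>f\<close>, then \<open>\<parallel>f\<parallel>\<close> is controlled by the
  measure of \<open>C\<close>, while \<open>\<langle>f, \<Psi>\<^sub>x\<rangle> = 1\<close> for some \<open>x\<close> in \<open>C\<close>.\<close>

lemma emeasure_bounded_below:
  assumes Riesz: "continuous_Riesz_basis M \<Psi>" and K: "0 < K"
  obtains \<delta> :: real where "0 < \<delta>"
    "\<And>C. C \<in> sets M \<Longrightarrow> emeasure M C \<noteq> 0 \<Longrightarrow> (\<And>x. x \<in> C \<Longrightarrow> norm (\<Psi> x) \<le> K) \<Longrightarrow> ennreal \<delta> \<le> emeasure M C"
proof -
  from Riesz obtain a where a: "0 < a"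
    and lo: "\<And>f. a * (norm f)\<^sup>2 \<le> (LINT x|M. (cmod (cinner f (\<Psi> x)))\<^sup>2)"
    unfolding continuous_Riesz_basis_def by (auto elim: continuous_frame_bounds)
  have [measurable]: "(\<lambda>x. cinner f (\<Psi> x)) \<in> borel_measurable M" for f
    using Riesz by (auto simp: continuous_Riesz_basis_def continuous_frame_def)
  have "ennreal (a / K\<^sup>2) \<le> emeasure M C"
    if C: "C \<in> sets M" "emeasure M C \<noteq> 0" "\<And>x. x \<in> C \<Longrightarrow> norm (\<Psi> x) \<le> K" for C
  proof (cases "emeasure M C < \<infinity>")
    case True
    obtain f where f: "AE x in M. cinner f (\<Psi> x) = indicator C x"
      using analysis_op_surj[OF Riesz indicator_in_L2_set_of[OF C(1) True]] .
    have "(LINT x|M. (cmod (cinner f (\<Psi> x)))\<^sup>2) = (LINT x|M. indicator C x)"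
    proof (rule integral_cong_AE)
      show "(\<lambda>x. (cmod (cinner f (\<Psi> x)))\<^sup>2) \<in> borel_measurable M"
        by measurable
      show "AE x in M. (cmod (cinner f (\<Psi> x)))\<^sup>2 = indicator C x"
        using f by eventually_elim (simp split: split_indicator)
    qed (use C in measurable)
    then have le: "a * (norm f)\<^sup>2 \<le> measure M C"
      using lo[of f] C(1) sets.sets_into_space[OF C(1)] by (simp add: Int_absorb2)
    from f have "AE x in M. x \<in> C \<longrightarrow> cinner f (\<Psi> x) = 1"
      by eventually_elim (auto split: split_indicator)
    from AE_imp_ex_mem[OF this C(2)] obtain x where x: "x \<in> C" "cinner f (\<Psi> x) = 1" by auto
    have "1 \<le> norm f * norm (\<Psi> x)"
      using cmod_cinner_le[of f "\<Psi> x"] x(2) by simp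
    also have "\<dots> \<le> norm f * K"
      using C(3)[OF x(1)] by (simp add: mult_left_mono)
    \<comment> \<open>Squaring allows \<open>1 \<le> norm f * K\<close> to be combined with
      \<open>a * (norm f)\<^sup>2 \<le> measure M C\<close>, which produces the bound
      \<open>a / K\<^sup>2\<close>.\<close>
    finally have "1 \<le> (norm f * K)\<^sup>2"
      by (rule one_le_power)
    then have "a * 1 \<le> a * (norm f * K)\<^sup>2"
      using a by (intro mult_left_mono) auto
    also have "\<dots> = (a * (norm f)\<^sup>2) * K\<^sup>2"
      by (simp add: power_mult_distrib)
    also have "\<dots> \<le> measure M C * K\<^sup>2"
      using le by (intro mult_right_mono) auto
    finally have "a / K\<^sup>2 \<le> measure M C"
      using K by (simp add: divide_le_eq)
    then show ?thesis
      using True by (simp add: emeasure_eq_ennreal_measure ennreal_leI less_top)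
  qed (simp add: not_less top_unique)
  then show thesis
    using a K by (intro that[of "a / K\<^sup>2"]) simp_all
qed

text \<open>An infinite level set would contain a set \<open>Z\<close> of finite positive measure
  whose indicator is represented by some \<open>f\<close>. Since \<open>cinner f (\<Psi> x)\<close>
  is constant on the level set and equals 1 on \<open>Z\<close>, the level set would lie in
  \<open>Z\<close> up to a null set.\<close>

lemma level_set_finite:
  assumes "sigma_finite_measure M" and Riesz: "continuous_Riesz_basis M \<Psi>"
    and L: "{x \<in> space M. \<Psi> x = v} \<in> sets M"
  shows "emeasure M {x \<in> space M. \<Psi> x = v} < \<infinity>"
proof (rule ccontr)
  interpret sigma_finite_measure M by fact
  let ?L = "{x \<in> space M. \<Psi> x = v}"
  assume "\<not> ?thesis"
  then have inf: "emeasure M ?L = \<infinity>" by (simp add: not_less top_unique)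
  obtain Z where Z: "Z \<in> sets M" "Z \<subseteq> ?L" "emeasure M Z < \<infinity>" "ennreal 0 < emeasure M Z"
    by (rule approx_PInf_emeasure_with_finite[OF L inf])
  then have Z0: "emeasure M Z \<noteq> 0" by auto
  obtain f where f: "AE x in M. cinner f (\<Psi> x) = indicator Z x"
    using analysis_op_surj[OF Riesz indicator_in_L2_set_of[OF Z(1,3)]] .
  then have "AE x in M. x \<in> Z \<longrightarrow> cinner f (\<Psi> x) = 1"
    by eventually_elim auto
  from AE_imp_ex_mem[OF this Z0] Z(2) have v: "cinner f v = 1" by auto
  from f have "AE x in M. x \<in> ?L \<longrightarrow> x \<in> Z"
    by eventually_elim (use v in \<open>auto split: split_indicator_asm\<close>)
  then have "emeasure M ?L \<le> emeasure M Z"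
    using Z(1) by (rule emeasure_mono_AE)
  then show False using inf Z(3) by auto
qed

text \<open>Outside the level sets of positive measure, a set of nearly minimal positive measure inside
  \<open>{x. \<parallel>\<Psi>\<^sub>x\<parallel> \<le> K}\<close> would be an atom, so \<open>\<Psi>\<close> would be almost everywhere constant on it.\<close>

lemma AE_level_set_nonnull:
  fixes \<Psi> :: "'a \<Rightarrow> 'h::chilbert_space"
  assumes "sigma_finite_measure M" and Riesz: "continuous_Riesz_basis M \<Psi>"
    and D: "countable D" "closure D = (UNIV :: 'h set)"
  shows "AE x in M. emeasure M {y \<in> space M. \<Psi> y = \<Psi> x} \<noteq> 0"
proof -
  interpret sigma_finite_measure M by fact
  have meas [measurable]: "(\<lambda>x. cinner f (\<Psi> x)) \<in> borel_measurable M" for f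
    using Riesz by (auto simp: continuous_Riesz_basis_def continuous_frame_def)
  define L where "L v = {x \<in> space M. \<Psi> x = v}" for v
  have L [measurable]: "L v \<in> sets M" for v
    unfolding L_def by (rule level_set_measurable[OF D meas])
  define V where "V = {v. emeasure M (L v) \<noteq> 0}"
  have V: "countable V"
    unfolding V_def L_def using L by (intro countable_level_sets) (simp add: L_def)
  define N where "N = space M - (\<Union>v\<in>V. L v)"
  have [measurable]: "N \<in> sets M"
    unfolding N_def using V by (intro sets.Diff sets.countable_UN'') auto
  have null: "C \<in> null_sets M"
    if [measurable]: "C \<in> sets M" and C: "C \<subseteq> N" "emeasure M C < \<infinity>" "\<And>x. x \<in> C \<Longrightarrow> norm (\<Psi> x) \<le> K" and K: "0 < K" for C K
  proof (rule ccontr)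
    assume "C \<notin> null_sets M"
    then have C0: "emeasure M C \<noteq> 0" by auto
    obtain \<delta> :: real where \<delta>: "0 < \<delta>"
      "\<And>B. B \<in> sets M \<Longrightarrow> emeasure M B \<noteq> 0 \<Longrightarrow> (\<And>x. x \<in> B \<Longrightarrow> norm (\<Psi> x) \<le> K) \<Longrightarrow> ennreal \<delta> \<le> emeasure M B"
      using emeasure_bounded_below[OF Riesz K] by blast
    have fin: "B \<subseteq> C \<Longrightarrow> emeasure M B = ennreal (measure M B)" for B
      using emeasure_mono[of B C M] C(2) by (intro emeasure_eq_ennreal_measure) (auto simp: top_unique)
    have \<delta>_le: "\<delta> \<le> measure M B" if "B \<in> sets M" "B \<subseteq> C" "emeasure M B \<noteq> 0" for B
    proof -
      have "ennreal \<delta> \<le> ennreal (measure M B)"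
        using \<delta>(2)[OF that(1,3)] that(2) C(3) fin[OF that(2)] by (metis subsetD)
      then show ?thesis by (simp add: ennreal_le_iff)
    qed
    define T where "T = measure M ` {B \<in> sets M. B \<subseteq> C \<and> emeasure M B \<noteq> 0}"
    have "T \<noteq> {}" using C0 by (auto simp: T_def)
    have "bdd_below T" by (rule bdd_belowI[where m = 0]) (auto simp: T_def)
    \<comment> \<open>If a set of measure below \<open>Inf T + \<delta>\<close> split into two
      non-null parts, one would have measure at least \<open>Inf T\<close> and the other at least
      \<open>\<delta>\<close>, which is too much. Hence the chosen \<open>E\<close> is an
      atom.\<close>
    have "\<exists>t\<in>T. t < Inf T + \<delta>"
      using cInf_lessD[OF \<open>T \<noteq> {}\<close>, of "Inf T + \<delta>"] \<delta>(1) by auto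
    then obtain E where E [measurable]: "E \<in> sets M" and EC: "E \<subseteq> C" and E0: "emeasure M E \<noteq> 0"
      and E_lt: "measure M E < Inf T + \<delta>"
      by (auto simp: T_def)
    have atom: "emeasure M P = 0 \<or> emeasure M (E - P) = 0" if [measurable]: "P \<in> sets M" and P: "P \<subseteq> E" for P
    proof (rule ccontr)
      assume "\<not> ?thesis"
      then have *: "emeasure M P \<noteq> 0" "emeasure M (E - P) \<noteq> 0" by auto
      have "Inf T \<le> measure M P"
        using * P EC by (intro cInf_lower \<open>bdd_below T\<close>) (auto simp: T_def)
      moreover have "\<delta> \<le> measure M (E - P)"
        using * EC by (intro \<delta>_le) auto
      moreover have "measure M E = measure M P + measure M (E - P)"
        using P EC fin[OF EC] by (subst measure_Diff) (auto simp: less_top[symmetric])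
      ultimately show False using E_lt by linarith
    qed
    have "\<exists>c. AE x in M. x \<in> E \<longrightarrow> cinner f (\<Psi> x) = c" for f
      using atom_AE_const[OF meas E E0 atom] by blast
    then obtain c where "\<And>f. AE x in M. x \<in> E \<longrightarrow> cinner f (\<Psi> x) = c f"
      by metis
    \<comment> \<open>The exceptional null set depends on \<open>f\<close>; restricting to the
      countable set \<open>D\<close> leaves a single one.\<close>
    then have c: "AE x in M. \<forall>f\<in>D. x \<in> E \<longrightarrow> cinner f (\<Psi> x) = c f"
      by (intro AE_ball_countable' D(1))
    then have "AE x in M. x \<in> E \<longrightarrow> (\<forall>f\<in>D. cinner f (\<Psi> x) = c f)"
      by eventually_elim auto
    from AE_imp_ex_mem[OF this E0] obtain z where z: "z \<in> E" "\<And>f. f \<in> D \<Longrightarrow> cinner f (\<Psi> z) = c f"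
      by auto
    from c AE_space have "AE x in M. x \<in> E \<longrightarrow> x \<in> L (\<Psi> z)"
    proof eventually_elim
      case (elim x)
      then show ?case
        using cinner_eq_on_dense[OF D(2), of "\<Psi> x" "\<Psi> z"] z(2) by (auto simp: L_def)
    qed
    \<comment> \<open>The level set through \<open>z\<close> inherits positive measure from
      \<open>E\<close>, although \<open>z\<close> lies in \<open>N\<close>, where all such level
      sets have been removed.\<close>
    then have "emeasure M E \<le> emeasure M (L (\<Psi> z))"
      by (rule emeasure_mono_AE) measurable
    then have "\<Psi> z \<in> V"
      using E0 by (auto simp: V_def)
    moreover have "z \<in> N" using z(1) EC C(1) by auto
    ultimately show False by (auto simp: N_def L_def)
  qed
  obtain F :: "nat \<Rightarrow> 'a set" where F: "range F \<subseteq> sets M" "(\<Union>i. F i) = space M" "\<And>i. emeasure M (F i) \<noteq> \<infinity>"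
    using sigma_finite by metis
  have [measurable]: "F i \<in> sets M" for i using F(1) by auto
  have [measurable]: "{x \<in> space M. norm (\<Psi> x) \<le> real (Suc k)} \<in> sets M" for k
    by (rule norm_le_set_measurable[OF D meas]) simp
  \<comment> \<open>Countably many pieces of the kind covered by \<open>null\<close> exhaust
    \<open>N\<close>. The bound is \<open>Suc k\<close> because \<open>null\<close> asks for a
    positive \<open>K\<close>.\<close>
  let ?G = "\<lambda>i k. N \<inter> F i \<inter> {x \<in> space M. norm (\<Psi> x) \<le> real (Suc k)}"
  have "?G i k \<in> null_sets M" for i k
  proof (rule null)
    show "?G i k \<in> sets M" by measurable
    have "emeasure M (?G i k) \<le> emeasure M (F i)"
      by (intro emeasure_mono) auto
    then show "emeasure M (?G i k) < \<infinity>"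
      using F(3)[of i] by (auto simp: less_top top_unique)
  qed auto
  then have null_UN: "(\<Union>i. \<Union>k. ?G i k) \<in> null_sets M"
    by (intro null_sets_UN)
  have "N \<subseteq> (\<Union>i. \<Union>k. ?G i k)"
  proof
    fix x assume x: "x \<in> N"
    then have "x \<in> space M" by (simp add: N_def)
    then obtain i where "x \<in> F i" using F(2) by auto
    moreover obtain k where "norm (\<Psi> x) \<le> real k"
      using real_arch_simple by blast
    ultimately show "x \<in> (\<Union>i. \<Union>k. ?G i k)"
      using x \<open>x \<in> space M\<close> by (intro UN_I[of i] UN_I[of k]) auto
  qed
  then have "N \<in> null_sets M"
    by (rule null_sets_subset[OF null_UN \<open>N \<in> sets M\<close>])
  then have "AE x in M. x \<notin> N" by (rule AE_not_in)
  with AE_space show ?thesis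
    by eventually_elim (auto simp: N_def V_def L_def)
qed

section \<open>Passage to the discrete family\<close>

text \<open>Bridges two kinds of sums: the series over all naturals produced by countable
  additivity, padded with zeros outside \<open>I\<close>, and the unordered sums over
  \<open>I\<close> in the definitions of discrete frames and \<open>ell2_on\<close>.\<close>

lemma suminf_ennreal_if_mem:
  fixes f :: "nat \<Rightarrow> real"
  assumes f: "\<And>i. 0 \<le> f i"
  shows "(\<Sum>i. ennreal (if i \<in> I then f i else 0)) < \<infinity> \<longleftrightarrow> f summable_on I"
    and "f summable_on I \<Longrightarrow> (\<Sum>i. ennreal (if i \<in> I then f i else 0)) = ennreal (infsum f I)"
proof -
  let ?g = "\<lambda>i. if i \<in> I then f i else 0"
  have g: "0 \<le> ?g i" for i using f by simp
  have iff: "?g summable_on UNIV \<longleftrightarrow> f summable_on I"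
    by (rule summable_on_cong_neutral) auto
  have sum: "infsum ?g UNIV = infsum f I"
    by (rule infsum_cong_neutral) auto
  have eq: "(\<Sum>i. ennreal (?g i)) = ennreal (infsum f I)" if "f summable_on I"
  proof (rule suminf_ennreal_eq[OF g])
    from that have "?g summable_on UNIV" by (simp only: iff)
    then show "?g sums infsum f I"
      unfolding sum[symmetric] by (intro has_sum_imp_sums has_sum_infsum)
  qed
  show "f summable_on I \<Longrightarrow> (\<Sum>i. ennreal (?g i)) = ennreal (infsum f I)" by (rule eq)
  show "(\<Sum>i. ennreal (?g i)) < \<infinity> \<longleftrightarrow> f summable_on I"
  proof
    assume "(\<Sum>i. ennreal (?g i)) < \<infinity>"
    then have "summable ?g"
      by (intro summable_suminf_not_top g) auto
    then show "f summable_on I"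
      using summable_on_UNIV_nonneg_real_iff[of ?g] g iff by blast
  qed (simp add: eq)
qed

lemma nn_integral_AE_disjoint:
  fixes A :: "nat \<Rightarrow> 'a set"
  assumes A [measurable]: "\<And>i. A i \<in> sets M" and disj: "disjoint_family A"
    and cover: "AE x in M. x \<in> (\<Union>i. A i)" and h [measurable]: "h \<in> borel_measurable M"
  shows "(\<integral>\<^sup>+x. h x \<partial>M) = (\<Sum>i. \<integral>\<^sup>+x\<in>A i. h x \<partial>M)"
proof -
  have "(\<integral>\<^sup>+x. h x \<partial>M) = (\<integral>\<^sup>+x. (\<Sum>i. h x * indicator (A i) x) \<partial>M)"
    using cover
  proof (intro nn_integral_cong_AE, eventually_elim)
    case (elim x)
    then obtain i where "x \<in> A i" by auto
    from suminf_cmult_indicator[OF disj this, of "\<lambda>_. h x"] show ?case by simp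
  qed
  also have "\<dots> = (\<Sum>i. \<integral>\<^sup>+x\<in>A i. h x \<partial>M)"
    by (rule nn_integral_suminf) measurable
  finally show ?thesis .
qed

theorem corollary19:
  fixes M :: "'a measure" and \<Psi> :: "'a \<Rightarrow> 'h::chilbert_space"
  assumes "sigma_finite_measure M"
    and "emeasure M (space M) \<noteq> 0"
    and "separable_space (euclidean :: 'h topology)"
    and "continuous_Riesz_basis M \<Psi>"
  shows "\<exists>(I :: nat set) A \<psi>. written_as M \<Psi> I A \<psi> \<and> discrete_Riesz_basis I \<psi>"
proof -
  note Riesz = assms(4)
  interpret sigma_finite_measure M by fact
  obtain D :: "'h set" where D: "countable D" "closure D = UNIV"
    using assms(3) by (auto simp: separable_space_def)
  have meas [measurable]: "(\<lambda>x. cinner f (\<Psi> x)) \<in> borel_measurable M" for f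
    using Riesz by (auto simp: continuous_Riesz_basis_def continuous_frame_def)
  define L where "L v = {x \<in> space M. \<Psi> x = v}" for v
  have L [measurable]: "L v \<in> sets M" for v
    unfolding L_def by (rule level_set_measurable[OF D meas])
  have L_fin: "emeasure M (L v) = ennreal (measure M (L v))" for v
    using level_set_finite[OF assms(1) Riesz L[unfolded L_def], of v]
    by (intro emeasure_eq_ennreal_measure) (auto simp: L_def)
  define V where "V = {v. emeasure M (L v) \<noteq> 0}"
  have "countable V"
    unfolding V_def L_def by (intro countable_level_sets L[unfolded L_def])
  then obtain I :: "nat set" and e where e: "bij_betw e I V"
    by (rule countableE_bij)
  \<comment> \<open>Empty sets outside \<open>I\<close> make this a disjoint family over all
    naturals, as the series decomposition of the integral expects.\<close>
  define A where "A i = (if i \<in> I then L (e i) else {})" for i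
  \<comment> \<open>This factor transfers the measure of the piece to the vector:
    \<open>(s i)\<^sup>2\<close> is the measure of the level set, so the squared coefficient of
    \<open>\<psi> i\<close> is the integral over \<open>A i\<close>.\<close>
  define s where "s i = sqrt (measure M (L (e i)))" for i
  define \<psi> where "\<psi> i = s i *\<^sub>R e i" for i
  have A [measurable]: "A i \<in> sets M" for i by (simp add: A_def)
  have disj: "disjoint_family A"
    using e by (auto simp: disjoint_family_on_def A_def L_def bij_betw_def inj_on_eq_iff)
  have A_pos: "0 < emeasure M (A i)" if "i \<in> I" for i
    using bij_betwE[OF e] that by (auto simp: A_def V_def zero_less_iff_neq_zero)
  have emeasure_A: "emeasure M (A i) = ennreal ((s i)\<^sup>2)" if "i \<in> I" for i
    using that by (simp add: A_def s_def L_fin)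
  have s_nz: "s i \<noteq> 0" if "i \<in> I" for i
    using A_pos[OF that] emeasure_A[OF that] by auto
  have cover: "AE x in M. x \<in> (\<Union>i. A i)"
    using AE_level_set_nonnull[OF assms(1) Riesz D] AE_space
  proof eventually_elim
    case (elim x)
    then have "\<Psi> x \<in> V" by (simp add: V_def L_def)
    then obtain i where "i \<in> I" "e i = \<Psi> x"
      using e by (auto simp: bij_betw_def)
    then have "x \<in> A i" using elim by (simp add: A_def L_def)
    then show ?case by blast
  qed
  have piece: "(\<integral>\<^sup>+x\<in>A i. ennreal ((cmod (h x))\<^sup>2) \<partial>M) = ennreal ((cmod (of_real (s i) * c))\<^sup>2)"
    if "i \<in> I" "\<And>x. x \<in> A i \<Longrightarrow> h x = c" for i h c
  proof -
    have "(\<integral>\<^sup>+x\<in>A i. ennreal ((cmod (h x))\<^sup>2) \<partial>M) = (\<integral>\<^sup>+x. ennreal ((cmod c)\<^sup>2) * indicator (A i) x \<partial>M)"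
      using that(2) by (intro nn_integral_cong) (simp split: split_indicator)
    also have "\<dots> = ennreal ((cmod c)\<^sup>2) * ennreal ((s i)\<^sup>2)"
      using that(1) by (simp add: nn_integral_cmult_indicator emeasure_A)
    also have "\<dots> = ennreal ((cmod (of_real (s i) * c))\<^sup>2)"
      by (simp add: ennreal_mult[symmetric] norm_mult power_mult_distrib mult.commute)
    finally show ?thesis .
  qed
  \<comment> \<open>A Parseval-type identity for functions constant on each piece. It serves twice:
    for the frame inequalities of \<open>\<psi>\<close>, and to place the step function built from a
    given sequence in L2.\<close>
  have total: "(\<integral>\<^sup>+x. ennreal ((cmod (h x))\<^sup>2) \<partial>M) = (\<Sum>i. ennreal (if i \<in> I then (cmod (of_real (s i) * c i))\<^sup>2 else 0))"
    if [measurable]: "h \<in> borel_measurable M" and c: "\<And>i x. i \<in> I \<Longrightarrow> x \<in> A i \<Longrightarrow> h x = c i" for h c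
  proof -
    have "(\<integral>\<^sup>+x. ennreal ((cmod (h x))\<^sup>2) \<partial>M) = (\<Sum>i. \<integral>\<^sup>+x\<in>A i. ennreal ((cmod (h x))\<^sup>2) \<partial>M)"
      by (intro nn_integral_AE_disjoint A disj cover) measurable
    also have "\<dots> = (\<Sum>i. ennreal (if i \<in> I then (cmod (of_real (s i) * c i))\<^sup>2 else 0))"
    proof (rule suminf_cong)
      fix i
      show "(\<integral>\<^sup>+x\<in>A i. ennreal ((cmod (h x))\<^sup>2) \<partial>M) = ennreal (if i \<in> I then (cmod (of_real (s i) * c i))\<^sup>2 else 0)"
        using piece[of i h "c i"] c by (cases "i \<in> I") (auto simp: A_def)
    qed
    finally show ?thesis .
  qed
  have on_A: "cinner f (\<Psi> x) = cinner f (e i)" if "i \<in> I" "x \<in> A i" for f x i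
    using that by (auto simp: A_def L_def)
  have cinner_\<psi>: "cinner f (\<psi> i) = of_real (s i) * cinner f (e i)" for f i
    by (simp add: \<psi>_def cinner_scaleR_right)

  have "written_as M \<Psi> I A \<psi>"
    unfolding written_as_def
  proof (intro conjI ballI allI)
    show "disjoint_family_on A I"
      using disj by (auto simp: disjoint_family_on_def)
    show "AE x in M. x \<in> (\<Union>i\<in>I. A i)"
      using cover by eventually_elim (auto simp: A_def split: if_splits)
  next
    fix i f assume i: "i \<in> I"
    show "A i \<in> sets M" "0 < emeasure M (A i)"
      using A A_pos[OF i] by auto
    show "\<exists>c. AE x in M. x \<in> A i \<longrightarrow> cinner f (\<Psi> x) = c"
      using on_A[OF i] by (intro exI[of _ "cinner f (e i)"]) auto
    show "(\<integral>\<^sup>+x\<in>A i. ennreal ((cmod (cinner f (\<Psi> x)))\<^sup>2) \<partial>M) = ennreal ((cmod (cinner f (\<psi> i)))\<^sup>2)"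
      unfolding cinner_\<psi> by (intro piece i on_A)
  qed
  moreover have frame: "discrete_frame I \<psi>"
  proof -
    from Riesz obtain a b where ab: "0 < a" "0 < b"
      and lo: "\<And>f. ennreal (a * (norm f)\<^sup>2) \<le> (\<integral>\<^sup>+x. ennreal ((cmod (cinner f (\<Psi> x)))\<^sup>2) \<partial>M)"
      and up: "\<And>f. (\<integral>\<^sup>+x. ennreal ((cmod (cinner f (\<Psi> x)))\<^sup>2) \<partial>M) \<le> ennreal (b * (norm f)\<^sup>2)"
      unfolding continuous_Riesz_basis_def continuous_frame_def by auto
    have eq: "(\<integral>\<^sup>+x. ennreal ((cmod (cinner f (\<Psi> x)))\<^sup>2) \<partial>M) =
        (\<Sum>i. ennreal (if i \<in> I then (cmod (cinner f (\<psi> i)))\<^sup>2 else 0))" for f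
      unfolding cinner_\<psi> by (rule total[OF meas on_A])
    have summ: "(\<lambda>i. (cmod (cinner f (\<psi> i)))\<^sup>2) summable_on I" for f
      using up[of f] unfolding eq by (subst suminf_ennreal_if_mem(1)[symmetric]) (auto intro: le_less_trans)
    have "a * (norm f)\<^sup>2 \<le> (\<Sum>\<^sub>\<infinity>i\<in>I. (cmod (cinner f (\<psi> i)))\<^sup>2) \<and>
        (\<Sum>\<^sub>\<infinity>i\<in>I. (cmod (cinner f (\<psi> i)))\<^sup>2) \<le> b * (norm f)\<^sup>2" for f
      using lo[of f] up[of f] ab infsum_nonneg[of I "\<lambda>i. (cmod (cinner f (\<psi> i)))\<^sup>2"]
      unfolding eq suminf_ennreal_if_mem(2)[OF zero_le_power2 summ] by (simp add: ennreal_le_iff)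
    then show ?thesis
      unfolding discrete_frame_def using ab summ by blast
  qed
  moreover have "range (\<lambda>f. \<lambda>i\<in>I. cinner f (\<psi> i)) = ell2_on I"
  proof (intro equalityI subsetI)
    fix c assume "c \<in> range (\<lambda>f. \<lambda>i\<in>I. cinner f (\<psi> i))"
    then obtain f where c: "c = (\<lambda>i\<in>I. cinner f (\<psi> i))" by auto
    have "(\<lambda>i. (cmod (cinner f (\<psi> i)))\<^sup>2) summable_on I"
      using frame unfolding discrete_frame_def by blast
    then have "(\<lambda>i. (cmod (c i))\<^sup>2) summable_on I"
      by (rule summable_on_cong[THEN iffD1, rotated]) (simp add: c)
    then show "c \<in> ell2_on I" by (simp add: ell2_on_def c)
  next
    fix c assume "c \<in> ell2_on I"
    then have ext: "c \<in> extensional I" and c: "(\<lambda>i. (cmod (c i))\<^sup>2) summable_on I"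
      by (auto simp: ell2_on_def)
    \<comment> \<open>Dividing by \<open>s i\<close> anticipates the rescaling, so that the L2 norm
      of \<open>g\<close> equals the norm of \<open>c\<close> in \<open>ell2_on I\<close>. By
      disjointness at most one term of the series is nonzero at each \<open>x\<close>.\<close>
    define g :: "'a \<Rightarrow> complex" where "g x = (\<Sum>i. indicator (A i) x * (c i / of_real (s i)))" for x
    have g_meas [measurable]: "g \<in> borel_measurable M"
      unfolding g_def by measurable
    have g_A: "g x = c i / of_real (s i)" if "x \<in> A i" for x i
    proof -
      have "g x = (\<Sum>j\<in>{i}. indicator (A j) x * (c j / of_real (s j)))"
        unfolding g_def using disj that
        by (intro suminf_finite) (auto simp: disjoint_family_on_def split: split_indicator)
      then show ?thesis using that by simp
    qed
    have "(\<integral>\<^sup>+x. ennreal ((cmod (g x))\<^sup>2) \<partial>M) =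
        (\<Sum>i. ennreal (if i \<in> I then (cmod (of_real (s i) * (c i / of_real (s i))))\<^sup>2 else 0))"
      by (rule total) (auto intro: g_A)
    also have "\<dots> = (\<Sum>i. ennreal (if i \<in> I then (cmod (c i))\<^sup>2 else 0))"
      using s_nz by (intro suminf_cong) auto
    also have "\<dots> < \<infinity>"
      using c by (subst suminf_ennreal_if_mem(1)) auto
    finally have "g \<in> L2_set_of M"
      by (simp add: L2_set_of_iff_nn_integral)
    then obtain f where f: "AE x in M. cinner f (\<Psi> x) = g x"
      by (rule analysis_op_surj[OF Riesz])
    \<comment> \<open>On \<open>A i\<close> both sides of the almost everywhere identity are
      constant, and \<open>A i\<close> is not null, so the constants agree exactly.\<close>
    have "cinner f (\<psi> i) = c i" if i: "i \<in> I" for i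
    proof -
      have "AE x in M. x \<in> A i \<longrightarrow> cinner f (e i) = c i / of_real (s i)"
        using f by eventually_elim (use g_A on_A[OF i] in force)
      from AE_imp_ex_mem[OF this] A_pos[OF i] show ?thesis
        using s_nz[OF i] by (auto simp: cinner_\<psi>)
    qed
    \<comment> \<open>Outside \<open>I\<close> both sides are \<open>undefined\<close>, because
      \<open>c\<close> is extensional.\<close>
    then have "c = (\<lambda>i\<in>I. cinner f (\<psi> i))"
      using ext by (intro extensionalityI[of _ I]) auto
    then show "c \<in> range (\<lambda>f. \<lambda>i\<in>I. cinner f (\<psi> i))" by blast
  qed
  ultimately show ?thesis
    unfolding discrete_Riesz_basis_def by blast
qed

end
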